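(* Let $\Gamma$ be a finite simple graph with $E(\Gamma)\neq\emptyset$. Then $$\log\left(\frac14\right)\le h(\Gamma)\le \log\left(\frac34\right).$$
   Context: Let $\Gamma$ be a finite graph without loops or multiple edges, with vertex set $V(\Gamma)$, edge set $E(\Gamma)$, and $N_\Gamma=|E(\Gamma)|$. Let $I_\Gamma\subset V(\Gamma)\times E(\Gamma)$ be the set of pairs $(v,e)$ with $v$ an endpoint of $e$ (so $|I_\Gamma|=2N_\Gamma$). An orientation prescription is a function $\omega:I_\Gamma\to\{\pm1\}$; it orients each edge of the barycentric subdivision of $\Gamma$ (whose edges join a vertex $v$ to the midpoint $b_e$ of an incident edge $e$): the edge is oriented $b_e\to v$ if $\omega(v,e)=1$, and $v\to b_e$ if $\omega(v,e)=-1$. The prescription $\omega$ is a combinatorial flow if every vertex $v\in V(\Gamma)$ has at most one outgoing edge and every midpoint $b_e$ has at most one incoming edge; equivalently, for each $v$ there is at most one $e$ with $\omega(v,e)=-1$, and for each $e$ there is at most one $v$ with $\omega(v,e)=-1$. Let $P(\Gamma)$ be the probability that a uniformly random orientation prescription is a combinatorial flow, i.e. $P(\Gamma)=4^{-N_\Gamma}\cdot\#\{\text{combinatorial flows on }\Gamma\}$. Define $h(\Gamma)=\frac{\log P(\Gamma)}{N_\Gamma}$ if $E(\Gamma)\ne\emptyset$ and $h(\Gamma)=0$ otherwise. *)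

theory Defs
  imports "HOL-Probability.Probability"
begin

text \<open>A graph without loops or multiple edges: edges are two-element sets of vertices.\<close>

locale finite_simple_graph =
  fixes V :: "'a set" and E :: "'a set set"
  assumes finite_vertices: "finite V"
    and edge_subset: "e \<in> E \<Longrightarrow> e \<subseteq> V"
    and edge_card: "e \<in> E \<Longrightarrow> card e = 2"

definition incidence_pairs :: "'a set \<Rightarrow> 'a set set \<Rightarrow> ('a \<times> 'a set) set" where
  "incidence_pairs V E = {(v, e). v \<in> V \<and> e \<in> E \<and> v \<in> e}"

text \<open>Prescriptions are extensional functions (undefined off the incidence pairs), so that counting
  them counts functions on the incidence pairs.\<close>

definition orientation_prescriptions ::
  "'a set \<Rightarrow> 'a set set \<Rightarrow> ('a \<times> 'a set \<Rightarrow> int) set" where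
  "orientation_prescriptions V E = incidence_pairs V E \<rightarrow>\<^sub>E {-1, 1}"

text \<open>The oriented barycentric subdivision: \<open>Inl v\<close> is the vertex \<open>v\<close>, \<open>Inr e\<close> the midpoint of the
  edge \<open>e\<close>, and a pair \<open>(x, y)\<close> is an edge oriented from \<open>x\<close> to \<open>y\<close>.\<close>

definition subdivision_arcs ::
  "'a set \<Rightarrow> 'a set set \<Rightarrow> ('a \<times> 'a set \<Rightarrow> int) \<Rightarrow> (('a + 'a set) \<times> ('a + 'a set)) set" where
  "subdivision_arcs V E \<omega> =
     {(Inr e, Inl v) | v e. (v, e) \<in> incidence_pairs V E \<and> \<omega> (v, e) = 1} \<union>
     {(Inl v, Inr e) | v e. (v, e) \<in> incidence_pairs V E \<and> \<omega> (v, e) = -1}"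

definition combinatorial_flow ::
  "'a set \<Rightarrow> 'a set set \<Rightarrow> ('a \<times> 'a set \<Rightarrow> int) \<Rightarrow> bool" where
  "combinatorial_flow V E \<omega> \<longleftrightarrow>
     \<omega> \<in> orientation_prescriptions V E \<and>
     (\<forall>v\<in>V. \<exists>\<^sub>\<le>\<^sub>1 y. (Inl v, y) \<in> subdivision_arcs V E \<omega>) \<and>
     (\<forall>e\<in>E. \<exists>\<^sub>\<le>\<^sub>1 x. (x, Inr e) \<in> subdivision_arcs V E \<omega>)"

definition flow_probability :: "'a set \<Rightarrow> 'a set set \<Rightarrow> real" where
  "flow_probability V E =
     measure_pmf.prob (pmf_of_set (orientation_prescriptions V E)) {\<omega>. combinatorial_flow V E \<omega>}"

definition flow_entropy :: "'a set \<Rightarrow> 'a set set \<Rightarrow> real" where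
  "flow_entropy V E =
     (if E \<noteq> {} then ln (flow_probability V E) / real (card E) else 0)"

lemma combinatorial_flow_iff:
  "combinatorial_flow V E \<omega> \<longleftrightarrow>
     \<omega> \<in> orientation_prescriptions V E \<and>
     (\<forall>v\<in>V. \<exists>\<^sub>\<le>\<^sub>1 e. (v, e) \<in> incidence_pairs V E \<and> \<omega> (v, e) = -1) \<and>
     (\<forall>e\<in>E. \<exists>\<^sub>\<le>\<^sub>1 v. (v, e) \<in> incidence_pairs V E \<and> \<omega> (v, e) = -1)"
proof -
  have "(\<exists>\<^sub>\<le>\<^sub>1 y. (Inl v, y) \<in> subdivision_arcs V E \<omega>) \<longleftrightarrow>
      (\<exists>\<^sub>\<le>\<^sub>1 e. (v, e) \<in> incidence_pairs V E \<and> \<omega> (v, e) = -1)" for v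
    unfolding subdivision_arcs_def Uniq_def by auto
  moreover have "(\<exists>\<^sub>\<le>\<^sub>1 x. (x, Inr e) \<in> subdivision_arcs V E \<omega>) \<longleftrightarrow>
      (\<exists>\<^sub>\<le>\<^sub>1 v. (v, e) \<in> incidence_pairs V E \<and> \<omega> (v, e) = -1)" for e
    unfolding subdivision_arcs_def Uniq_def by auto
  ultimately show ?thesis
    unfolding combinatorial_flow_def by simp
qed

context finite_simple_graph
begin

lemma finite_edges: "finite E"
  by (rule finite_subset[of _ "Pow V"]) (use edge_subset finite_vertices in auto)

lemma card_incidence_pairs: "card (incidence_pairs V E) = 2 * card E"
proof -
  have eq: "incidence_pairs V E = (\<lambda>(e, v). (v, e)) ` (SIGMA e:E. e)"
    unfolding incidence_pairs_def using edge_subset by force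
  have "card (incidence_pairs V E) = card (SIGMA e:E. e)"
    unfolding eq by (rule card_image) (auto simp: inj_on_def)
  also have "\<dots> = (\<Sum>e\<in>E. card e)"
    using finite_edges edge_subset finite_vertices
    by (intro card_SigmaI) (auto intro: finite_subset)
  also have "\<dots> = 2 * card E"
    by (simp add: edge_card)
  finally show ?thesis .
qed

lemma finite_incidence_pairs: "finite (incidence_pairs V E)"
  by (rule finite_subset[of _ "V \<times> E"])
    (use finite_vertices finite_edges in \<open>auto simp: incidence_pairs_def\<close>)

lemma finite_orientation_prescriptions: "finite (orientation_prescriptions V E)"
  unfolding orientation_prescriptions_def
  using finite_incidence_pairs by (intro finite_PiE) auto

lemma card_orientation_prescriptions: "card (orientation_prescriptions V E) = 4 ^ card E"
  unfolding orientation_prescriptions_def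
  by (simp add: card_PiE finite_incidence_pairs card_incidence_pairs power_mult numeral_2_eq_2[symmetric])

lemma flow_probability_eq:
  "flow_probability V E = real (card {\<omega>. combinatorial_flow V E \<omega>}) / 4 ^ card E"
proof -
  have "orientation_prescriptions V E \<noteq> {}"
    using card_orientation_prescriptions by (metis card.empty power_not_zero zero_neq_numeral)
  moreover have "orientation_prescriptions V E \<inter> {\<omega>. combinatorial_flow V E \<omega>}
      = {\<omega>. combinatorial_flow V E \<omega>}"
    by (auto simp: combinatorial_flow_def)
  ultimately show ?thesis
    unfolding flow_probability_def
    by (simp add: measure_pmf_of_set finite_orientation_prescriptions
        card_orientation_prescriptions)
qed

end

end

theory Submission
  imports Defs
begin

text \<open>The prescription that is constantly \<open>1\<close> is a flow. In a flow, the endpoints \<open>v\<close> of an edge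
  \<open>e\<close> with \<open>\<omega> (v, e) = -1\<close> form a proper subset of \<open>e\<close>, which leaves three
  possibilities per edge, and these subsets determine the flow.\<close>

context finite_simple_graph
begin

lemma finite_combinatorial_flows: "finite {\<omega>. combinatorial_flow V E \<omega>}"
  by (rule finite_subset[OF _ finite_orientation_prescriptions])
    (auto simp: combinatorial_flow_def)

text \<open>No pair has value -1, so both at-most-one conditions hold vacuously. Restricting to the
  incidence pairs makes the constant function extensional, as a prescription must be.\<close>

lemma combinatorial_flow_const_1:
  "combinatorial_flow V E (\<lambda>p\<in>incidence_pairs V E. 1)"
  unfolding combinatorial_flow_iff orientation_prescriptions_def Uniq_def
  by (auto split: if_splits)

lemma card_combinatorial_flows_le:
  "card {\<omega>. combinatorial_flow V E \<omega>} \<le> 3 ^ card E"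
proof -
  let ?F = "{\<omega>. combinatorial_flow V E \<omega>}"
  \<comment> \<open>Restricting to \<open>E\<close> makes \<open>out \<omega>\<close> extensional,
    so that its values can be counted inside a \<open>PiE\<close> product.\<close>
  define out where "out \<omega> = (\<lambda>e\<in>E. {v \<in> e. \<omega> (v, e) = -1})" for \<omega> :: "'a \<times> 'a set \<Rightarrow> int"
  have "inj_on out ?F"
  proof (rule inj_onI)
    fix \<omega> \<omega>'
    assume flows: "\<omega> \<in> ?F" "\<omega>' \<in> ?F" and eq: "out \<omega> = out \<omega>'"
    then have P: "\<omega> \<in> incidence_pairs V E \<rightarrow>\<^sub>E {-1, 1}" "\<omega>' \<in> incidence_pairs V E \<rightarrow>\<^sub>E {-1, 1}"
      by (auto simp: combinatorial_flow_def orientation_prescriptions_def)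
    show "\<omega> = \<omega>'"
    \<comment> \<open>Off the incidence pairs both functions are \<open>undefined\<close>; on a
      pair, the only values are -1 and 1, so knowing where -1 occurs is enough.\<close>
    proof (rule PiE_ext[OF P])
      fix p assume p: "p \<in> incidence_pairs V E"
      then obtain v e where ve: "p = (v, e)" "e \<in> E" "v \<in> e"
        by (auto simp: incidence_pairs_def)
      have "{v \<in> e. \<omega> (v, e) = -1} = {v \<in> e. \<omega>' (v, e) = -1}"
        using fun_cong[OF eq, of e] ve by (simp add: out_def)
      then have "\<omega> p = -1 \<longleftrightarrow> \<omega>' p = -1"
        using ve by auto
      moreover have "\<omega> p \<in> {-1, 1}" "\<omega>' p \<in> {-1, 1}"
        using P p by (auto dest: PiE_mem)
      ultimately show "\<omega> p = \<omega>' p"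
        by auto
    qed
  qed
  moreover have "out ` ?F \<subseteq> (\<Pi>\<^sub>E e\<in>E. Pow e - {e})"
  proof (intro image_subsetI PiE_I)
    fix \<omega> e
    assume "\<omega> \<in> ?F" and e: "e \<in> E"
    then have uniq: "\<exists>\<^sub>\<le>\<^sub>1 v. (v, e) \<in> incidence_pairs V E \<and> \<omega> (v, e) = -1"
      by (simp add: combinatorial_flow_iff)
    obtain u w where uw: "e = {u, w}" "u \<noteq> w"
      using edge_card[OF e] by (auto simp: card_2_iff)
    have "(u, e) \<in> incidence_pairs V E" "(w, e) \<in> incidence_pairs V E"
      using e edge_subset[OF e] uw by (auto simp: incidence_pairs_def)
    \<comment> \<open>Two values -1 on the same edge would force \<open>u = w\<close> by the
      condition at its midpoint.\<close>
    then have "\<not> (\<omega> (u, e) = -1 \<and> \<omega> (w, e) = -1)"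
      using uniq uw(2) by (auto dest: Uniq_D)
    then have "{v \<in> e. \<omega> (v, e) = -1} \<noteq> e"
      using uw(1) by blast
    then show "out \<omega> e \<in> Pow e - {e}"
      using e by (auto simp: out_def)
  qed (simp add: out_def)
  moreover have fin: "finite e" if "e \<in> E" for e
    using edge_subset[OF that] finite_vertices by (rule finite_subset)
  then have "finite (\<Pi>\<^sub>E e\<in>E. Pow e - {e})"
    using finite_edges by (intro finite_PiE) auto
  ultimately have "card ?F \<le> card (\<Pi>\<^sub>E e\<in>E. Pow e - {e})"
    by (rule card_inj_on_le)
  also have "\<dots> = (\<Prod>e\<in>E. card (Pow e - {e}))"
    by (rule card_PiE[OF finite_edges])
  also have "\<dots> = (\<Prod>e\<in>E. 3)"
    \<comment> \<open>A two-element edge has 4 subsets; discarding the edge itself leaves 3.\<close>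
    by (intro prod.cong) (auto simp: card_Diff_singleton card_Pow fin edge_card)
  finally show ?thesis
    by simp
qed

text \<open>The number of flows lies between 1 and \<open>3 ^ card E\<close>, and there are
  \<open>4 ^ card E\<close> prescriptions.\<close>

lemma flow_probability_bounds:
  "(1 / 4) ^ card E \<le> flow_probability V E" "flow_probability V E \<le> (3 / 4) ^ card E"
proof -
  have "1 \<le> card {\<omega>. combinatorial_flow V E \<omega>}"
    using combinatorial_flow_const_1 finite_combinatorial_flows
    by (auto simp: Suc_le_eq card_gt_0_iff)
  then show "(1 / 4) ^ card E \<le> flow_probability V E"
    by (simp add: flow_probability_eq power_divide divide_right_mono)
  have "real (card {\<omega>. combinatorial_flow V E \<omega>}) \<le> 3 ^ card E"
    using of_nat_mono[OF card_combinatorial_flows_le, where 'a = real] by simp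
  then show "flow_probability V E \<le> (3 / 4) ^ card E"
    by (simp add: flow_probability_eq power_divide divide_right_mono)
qed

end

theorem mainTheorem1:
  fixes V :: "'a set" and E :: "'a set set"
  assumes "finite_simple_graph V E"
    and "E \<noteq> {}"
  shows "ln (1 / 4) \<le> flow_entropy V E \<and> flow_entropy V E \<le> ln (3 / 4)"
proof -
  interpret finite_simple_graph V E by fact
  let ?P = "flow_probability V E"
  have N: "0 < real (card E)"
    using assms(2) finite_edges by (simp add: card_gt_0_iff)
  \<comment> \<open>Monotonicity of \<open>ln\<close> in the upper bound needs a positive
    probability, which the lower bound supplies.\<close>
  have pos: "0 < ?P"
    by (rule less_le_trans[OF _ flow_probability_bounds(1)]) simp
  have "real (card E) * ln (1 / 4) = ln ((1 / 4) ^ card E)"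
    by (rule ln_realpow[symmetric])
  also have "\<dots> \<le> ln ?P"
    using flow_probability_bounds(1) by (intro ln_mono) simp_all
  finally have lower: "real (card E) * ln (1 / 4) \<le> ln ?P" .
  have "ln ?P \<le> ln ((3 / 4) ^ card E)"
    using flow_probability_bounds(2) pos by (intro ln_mono) simp_all
  also have "\<dots> = real (card E) * ln (3 / 4)"
    by (rule ln_realpow)
  finally have upper: "ln ?P \<le> real (card E) * ln (3 / 4)" .
  have "flow_entropy V E = ln ?P / real (card E)"
    using assms(2) by (simp add: flow_entropy_def)
  with lower upper N show ?thesis
    \<comment> \<open>Since \<open>E\<close> is nonempty, \<open>card E\<close> is positive and can
      be cleared from the quotient without reversing either inequality.\<close>
    by (simp only: pos_le_divide_eq pos_divide_le_eq mult.commute)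
qed

end
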